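(* For every $n\ge 1$, the graphic matroid $M(S_n)$ of the square of the path on $n$ vertices is isomorphic to the graphic matroid $M(F_n)$ of the fan graph $F_n$.
   Context: $S_n$ is the graph with vertex set $\{1,\dots,n\}$ in which $i$ and $j$ are adjacent iff $1\le|i-j|\le 2$ (the path $1,2,\dots,n$ together with edges joining vertices at distance two in it). The fan graph $F_n$ has vertex set $\{0,1,\dots,n\}$ and edges $\{i,i+1\}$ for $1\le i<n$ and $\{0,i\}$ for $1\le i\le n$. The graphic matroid $M(G)$ of a graph $G$ has ground set $E(G)$ and independent sets the edge sets of forests of $G$.
   Formalization: As printed the claim fails for every n (S_1 has no edge, F_1 has one; for n ≥ 2 the edge counts are 2n−3 and 2n−1); the theorem proved is that M(S_n) is isomorphic to M(F_{n−1}), the fan on n vertices, for every n ≥ 1. *)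

theory Defs
  imports Main
begin

record 'a ugraph =
  verts :: "'a set"
  edges :: "'a set set"

definition path_square :: "nat \<Rightarrow> nat ugraph" where
  "path_square n = \<lparr>verts = {1..n},
     edges = {{i, j} | i j. i \<in> {1..n} \<and> j \<in> {1..n} \<and>
                            1 \<le> \<bar>int i - int j\<bar> \<and> \<bar>int i - int j\<bar> \<le> 2}\<rparr>"

(* The index counts the vertices of the rim, so fan_graph n has n + 1 vertices and rank n, whereas
   path_square n has n vertices and rank n - 1 (for n >= 1).  The fan on the same number of vertices
   as path_square n is therefore fan_graph (n - 1), and fan_graph 0 is a single vertex. *)
definition fan_graph :: "nat \<Rightarrow> nat ugraph" where
  "fan_graph n = \<lparr>verts = {0..n},
     edges = {{i, i + 1} | i. 1 \<le> i \<and> i < n} \<union> {{0, i} | i. 1 \<le> i \<and> i \<le> n}\<rparr>"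

(* A cycle is given by its vertices in cyclic order, without repeating the first one at the end. *)
definition is_cycle :: "'a ugraph \<Rightarrow> 'a list \<Rightarrow> bool" where
  "is_cycle G vs \<longleftrightarrow> length vs \<ge> 3 \<and> distinct vs \<and> set vs \<subseteq> verts G \<and>
     (\<forall>k < length vs. {vs ! k, vs ! ((k + 1) mod length vs)} \<in> edges G)"

definition forest :: "'a ugraph \<Rightarrow> bool" where
  "forest G \<longleftrightarrow> (\<nexists>vs. is_cycle G vs)"

(* Only the data of a matroid; the axioms are not part of the type.  Edge sets of forests are
   closed under subsets and satisfy the exchange property, so they hold for graphic_matroid G
   with G finite. *)
record 'e matroid =
  ground :: "'e set"
  indep :: "'e set set"

definition graphic_matroid :: "'a ugraph \<Rightarrow> 'a set matroid" where
  "graphic_matroid G = \<lparr>ground = edges G,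
     indep = {F. F \<subseteq> edges G \<and> forest \<lparr>verts = verts G, edges = F\<rparr>}\<rparr>"

definition matroid_iso :: "'e matroid \<Rightarrow> 'f matroid \<Rightarrow> bool" where
  "matroid_iso M N \<longleftrightarrow> (\<exists>f. bij_betw f (ground M) (ground N) \<and>
     (\<forall>X \<subseteq> ground M. X \<in> indep M \<longleftrightarrow> f ` X \<in> indep N))"

end

theory Submission
  imports Defs
begin

text \<open>
  The isomorphism sends \<open>{i, i + 1}\<close> to the spoke \<open>{0, i}\<close> and \<open>{i, i + 2}\<close> to the rim edge
  \<open>{i, i + 1}\<close>. An edge set is a forest iff no nonempty subset of it has all degrees even, so it
  suffices to compare the even edge sets. Write \<open>short i\<close> and \<open>long i\<close> for the indicators of
  \<open>{i, i + 1}\<close> and \<open>{i, i + 2}\<close> in a set of edges of the square of the path. The degree of its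
  image at \<open>i > 0\<close> in the fan is \<open>g i = short i + long i + long (i - 1)\<close>, and the degree of the
  set itself at \<open>i\<close> is congruent to \<open>g i + g (i - 1)\<close> modulo 2, where \<open>g 0 = 0\<close>.
\<close>

section \<open>Forests and even edge sets\<close>

text \<open>For a finite graph, the sets in \<open>edges G\<close> with this property form its cycle
  space over GF(2). No vertex set is needed: a \<open>v\<close> outside the graph has degree
  0.\<close>

definition even_edges :: "'a set set \<Rightarrow> bool" where
  "even_edges C \<longleftrightarrow> (\<forall>v. even (card {e \<in> C. v \<in> e}))"

text \<open>The edges of the cycle serve as \<open>C\<close>: a vertex on it meets exactly the edges
  leaving and entering it, any other vertex meets none.\<close>

lemma cycle_even_edges:
  assumes "is_cycle G vs"
  obtains C where "C \<subseteq> edges G" "C \<noteq> {}" "even_edges C"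
proof -
  define l where "l = length vs"
  define E where "E k = {vs ! k, vs ! ((k + 1) mod l)}" for k
  have l: "l \<ge> 3" and dist: "distinct vs" and E: "\<And>k. k < l \<Longrightarrow> E k \<in> edges G"
    using assms by (auto simp: is_cycle_def l_def E_def)
  have nth_eq: "vs ! i = vs ! j \<longleftrightarrow> i = j" if "i < l" "j < l" for i j
    using that dist by (simp add: l_def nth_eq_iff_index_eq)
  have "even (card {e \<in> E ` {..<l}. v \<in> e})" for v
  proof (cases "v \<in> set vs")
    case True
    then obtain j where j: "j < l" "v = vs ! j"
      by (auto simp: in_set_conv_nth l_def)
    \<comment> \<open>The cyclic predecessor of \<open>j\<close>; the edges at \<open>v\<close> are
      then \<open>E j\<close> and \<open>E p\<close>.\<close>
    define p where "p = (if j = 0 then l - 1 else j - 1)"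
    have succ: "(k + 1) mod l = (if k = l - 1 then 0 else k + 1)" if "k < l" for k
      using that l by auto
    have p: "p < l" "(p + 1) mod l = j"
      using j l by (auto simp: p_def)
    have "{e \<in> E ` {..<l}. v \<in> e} = {E j, E p}"
    proof -
      have "k = j \<or> k = p" if k: "k < l" and v: "v \<in> E k" for k
      proof -
        have "(k + 1) mod l < l" using l by simp
        then have "j = k \<or> j = (k + 1) mod l"
          using v j k nth_eq by (auto simp: E_def)
        then show ?thesis
          using k j unfolding succ[OF k] p_def by (auto split: if_splits)
      qed
      moreover have "v \<in> E j" "v \<in> E p"
        using j p by (auto simp: E_def)
      ultimately show ?thesis
        using j(1) p(1) by blast
    qed
    \<comment> \<open>This is where length at least 3 enters: otherwise the successor and the
      predecessor of \<open>j\<close> could coincide.\<close>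
    moreover have "E j \<noteq> E p"
    proof
      assume "E j = E p"
      then have "vs ! ((j + 1) mod l) \<in> {vs ! p, vs ! j}"
        using p by (auto simp: E_def)
      moreover have "(j + 1) mod l < l" using l by simp
      ultimately have "(j + 1) mod l = p \<or> (j + 1) mod l = j"
        using nth_eq j p by auto
      then show False
        using l j unfolding succ[OF j(1)] p_def by (auto split: if_splits)
    qed
    ultimately show ?thesis by simp
  next
    case False
    have "(k + 1) mod l < l" for k using l by simp
    then have "v \<notin> E k" if "k < l" for k
      using False that by (auto simp: E_def l_def)
    then have "{e \<in> E ` {..<l}. v \<in> e} = {}"
      by auto
    then show ?thesis by (simp only: card.empty even_zero)
  qed
  then show thesis
    using l E by (intro that[of "E ` {..<l}"]) (auto simp: even_edges_def lessThan_empty_iff)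
qed

text \<open>The initial vertex of a longest path has a second neighbour, which must lie on the path.\<close>
lemma even_edges_cycle:
  assumes fin: "finite (edges G)" and graph: "\<forall>e \<in> edges G. e \<subseteq> verts G \<and> card e = 2"
    and C: "C \<subseteq> edges G" "C \<noteq> {}" "even_edges C"
  shows "\<exists>vs. is_cycle G vs"
proof -
  \<comment> \<open>Vertices are confined to the finite set \<open>\<Union>C\<close>, which bounds
    the length, so a longest path exists.\<close>
  define path where "path vs \<longleftrightarrow> distinct vs \<and> set vs \<subseteq> \<Union>C \<and>
    (\<forall>k. k + 1 < length vs \<longrightarrow> {vs ! k, vs ! (k + 1)} \<in> C)" for vs
  have card2: "\<And>e. e \<in> C \<Longrightarrow> card e = 2" using graph C by blast
  have finC: "finite C" using C(1) fin by (rule finite_subset)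
  have finU: "finite (\<Union>C)"
    using finC card2 by (metis card.infinite finite_Union zero_neq_numeral)
  have "length vs \<le> card (\<Union>C)" if "path vs" for vs
    using that finU by (metis card_mono distinct_card path_def)
  moreover obtain a b where ab: "{a, b} \<in> C" "a \<noteq> b"
    using C(2) card2 by (metis card_2_iff ex_in_conv)
  moreover from ab have p2: "path [a, b]"
    by (auto simp: path_def)
  ultimately obtain vs where vs: "path vs" "\<And>ws. path ws \<Longrightarrow> length ws \<le> length vs"
    using ex_has_greatest_nat[of path "[a, b]" length "Suc (card (\<Union>C))"]
    by (metis le_imp_less_Suc less_imp_le)
  have len: "length vs \<ge> 2" using vs(2)[OF p2] by simp
  define u where "u = vs ! 0"
  have e: "{u, vs ! 1} \<in> C"
    using vs(1) len by (auto simp: path_def u_def)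
  \<comment> \<open>The degree of \<open>u\<close> is even, so its first path edge is not the only
    edge at \<open>u\<close>.\<close>
  have "{e \<in> C. u \<in> e} \<noteq> {{u, vs ! 1}}"
  proof
    assume "{e \<in> C. u \<in> e} = {{u, vs ! 1}}"
    then have "card {e \<in> C. u \<in> e} = 1" by simp
    then show False using C(3) by (metis even_edges_def odd_one)
  qed
  then obtain e' where e': "e' \<in> C" "u \<in> e'" "e' \<noteq> {u, vs ! 1}"
    using e by blast
  then obtain w where w: "e' = {u, w}" "w \<noteq> u"
    using card2[OF e'(1)] by (auto simp: card_2_iff doubleton_eq_iff)
  have "w \<in> set vs"
  proof (rule ccontr)
    assume "w \<notin> set vs"
    then have "path (w # vs)"
      using vs(1) e' w len by (auto simp: path_def u_def nth_Cons insert_commute split: nat.split)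
    then show False using vs(2) by fastforce
  qed
  then obtain k where k: "k < length vs" "w = vs ! k"
    by (auto simp: in_set_conv_nth)
  \<comment> \<open>Position 0 would make \<open>e'\<close> a loop and position 1 would make it the
    first path edge.\<close>
  have k2: "k \<ge> 2"
  proof (rule ccontr)
    assume "\<not> k \<ge> 2"
    then have "k = 0 \<or> k = 1" by auto
    then show False using w k e' by (auto simp: u_def)
  qed
  \<comment> \<open>The segment from \<open>u\<close> to \<open>w\<close>, closed up by
    \<open>e'\<close>.\<close>
  let ?c = "take (k + 1) vs"
  have lc: "length ?c = k + 1" using k by simp
  have "{?c ! i, ?c ! ((i + 1) mod (k + 1))} \<in> edges G" if "i < k + 1" for i
  proof (cases "i = k")
    case True
    then show ?thesis using e' w k C(1) by (auto simp: u_def insert_commute)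
  next
    case False
    then have "i < k" using that by simp
    then show ?thesis using k vs(1) C(1) by (auto simp: path_def)
  qed
  moreover have "set ?c \<subseteq> verts G"
  proof -
    have "set ?c \<subseteq> set vs" by (rule set_take_subset)
    also have "\<dots> \<subseteq> \<Union>C" using vs(1) by (simp add: path_def)
    also have "\<dots> \<subseteq> verts G" using C(1) graph by blast
    finally show ?thesis .
  qed
  moreover have "distinct ?c" using vs(1) by (simp add: path_def)
  ultimately have "is_cycle G ?c"
    unfolding is_cycle_def lc using k2 by simp
  then show ?thesis ..
qed

lemma forest_iff_even_edges:
  assumes "finite (edges G)" "\<forall>e \<in> edges G. e \<subseteq> verts G \<and> card e = 2"
  shows "forest G \<longleftrightarrow> (\<forall>C \<subseteq> edges G. even_edges C \<longrightarrow> C = {})"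
  using even_edges_cycle[OF assms] cycle_even_edges[of G] unfolding forest_def by metis

section \<open>Graphic matroids and parity-preserving edge bijections\<close>

lemma matroid_iso_graphic_matroidI:
  assumes G: "finite (edges G)" "\<forall>e \<in> edges G. e \<subseteq> verts G \<and> card e = 2"
    and H: "finite (edges H)" "\<forall>e \<in> edges H. e \<subseteq> verts H \<and> card e = 2"
    and bij: "bij_betw f (edges G) (edges H)"
    and even: "\<And>C. C \<subseteq> edges G \<Longrightarrow> even_edges (f ` C) \<longleftrightarrow> even_edges C"
  shows "matroid_iso (graphic_matroid G) (graphic_matroid H)"
  unfolding matroid_iso_def
proof (intro exI conjI allI impI)
  show "bij_betw f (ground (graphic_matroid G)) (ground (graphic_matroid H))"
    using bij by (simp add: graphic_matroid_def)
next
  fix X assume "X \<subseteq> ground (graphic_matroid G)"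
  then have X: "X \<subseteq> edges G" by (simp add: graphic_matroid_def)
  then have fX: "f ` X \<subseteq> edges H" using bij by (auto simp: bij_betw_def)
  have "forest \<lparr>verts = verts G, edges = X\<rparr> \<longleftrightarrow> (\<forall>C \<subseteq> X. even_edges C \<longrightarrow> C = {})"
    using X G by (subst forest_iff_even_edges) (auto intro: finite_subset)
  also have "\<dots> \<longleftrightarrow> (\<forall>C \<subseteq> X. even_edges (f ` C) \<longrightarrow> f ` C = {})"
    using X even by (metis image_is_empty subset_trans)
  also have "\<dots> \<longleftrightarrow> (\<forall>D \<subseteq> f ` X. even_edges D \<longrightarrow> D = {})"
    by (metis subset_image_iff)
  also have "\<dots> \<longleftrightarrow> forest \<lparr>verts = verts H, edges = f ` X\<rparr>"
    using fX H by (subst forest_iff_even_edges) (auto intro: finite_subset)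
  finally show "X \<in> indep (graphic_matroid G) \<longleftrightarrow> f ` X \<in> indep (graphic_matroid H)"
    using X fX by (simp add: graphic_matroid_def)
qed

section \<open>The edge bijection\<close>

lemma edges_path_square:
  "edges (path_square n) =
     {{i, i + 1} | i. 1 \<le> i \<and> i < n} \<union> {{i, i + 2} | i. 1 \<le> i \<and> i + 1 < n}" (is "?L = ?A \<union> ?B")
proof (intro equalityI subsetI)
  fix e assume "e \<in> ?L"
  then obtain i j where e: "e = {i, j}" and ij: "i \<in> {1..n}" "j \<in> {1..n}"
    "1 \<le> \<bar>int i - int j\<bar>" "\<bar>int i - int j\<bar> \<le> 2"
    by (auto simp: path_square_def)
  from ij(3,4) consider "j = i + 1" | "i = j + 1" | "j = i + 2" | "i = j + 2"
    by linarith
  then show "e \<in> ?A \<union> ?B"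
    by cases (use e ij in \<open>auto simp: insert_commute\<close>)
next
  fix e assume "e \<in> ?A \<union> ?B"
  then show "e \<in> ?L"
    by (fastforce simp: path_square_def)
qed

text \<open>Applied to an explicit list of the possible edges at a vertex, this turns its degree
  into a sum of indicators.\<close>

lemma card_Int_insert:
  assumes "finite A" "x \<notin> A"
  shows "card (C \<inter> insert x A) = of_bool (x \<in> C) + card (C \<inter> A)"
  using assms by (auto simp: Int_insert_right)

lemma Collect_mem_eq_Int:
  assumes "\<And>e. e \<in> C \<Longrightarrow> v \<in> e \<Longrightarrow> e \<in> A" "\<forall>e \<in> A. v \<in> e"
  shows "{e \<in> C. v \<in> e} = C \<inter> A"
  using assms by blast

definition square_fan :: "nat set \<Rightarrow> nat set" where
  "square_fan e = (if Max e = Min e + 1 then {0, Min e} else {Min e, Min e + 1})"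

lemma square_fan_simps [simp]:
  "square_fan {i, Suc i} = {0, i}" "square_fan {i, Suc (Suc i)} = {i, Suc i}"
  by (auto simp: square_fan_def)

text \<open>The index ranges agree: \<open>1 \<le> i \<and> i < n\<close> for short edges and
  spokes, \<open>1 \<le> i \<and> i + 1 < n\<close> for long edges and rim edges.\<close>

lemma bij_betw_square_fan:
  "bij_betw square_fan (edges (path_square n)) (edges (fan_graph (n - 1)))"
proof (rule bij_betw_imageI)
  show "inj_on square_fan (edges (path_square n))"
    unfolding inj_on_def edges_path_square by (auto simp: doubleton_eq_iff)
  show "square_fan ` edges (path_square n) = edges (fan_graph (n - 1))" (is "?L = ?R")
  proof (intro equalityI subsetI)
    fix e assume "e \<in> ?L"
    then show "e \<in> ?R"
      unfolding edges_path_square fan_graph_def by fastforce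
  next
    fix e assume "e \<in> ?R"
    then consider i where "1 \<le> i" "i + 1 < n" "e = {i, Suc i}" | i where "1 \<le> i" "i < n" "e = {0, i}"
      unfolding fan_graph_def by fastforce
    then show "e \<in> ?L"
    proof cases
      case 1
      then have "{i, i + 2} \<in> edges (path_square n)" unfolding edges_path_square by blast
      then show ?thesis using 1 by (metis square_fan_simps(2) add_2_eq_Suc' imageI)
    next
      case 2
      then have "{i, i + 1} \<in> edges (path_square n)" unfolding edges_path_square by blast
      then show ?thesis using 2 by (metis square_fan_simps(1) Suc_eq_plus1 imageI)
    qed
  qed
qed

section \<open>Degrees in the two graphs\<close>

context
  fixes n :: nat and C :: "nat set set"
  assumes C: "C \<subseteq> edges (path_square n)"
begin

definition short :: "nat \<Rightarrow> nat" where
  "short i = of_bool ({i, Suc i} \<in> C)"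

definition long :: "nat \<Rightarrow> nat" where
  "long i = of_bool ({i, Suc (Suc i)} \<in> C)"

lemma edge_cases:
  assumes "e \<in> C"
  obtains i where "1 \<le> i" "i < n" "e = {i, Suc i}" | i where "1 \<le> i" "Suc i < n" "e = {i, Suc (Suc i)}"
proof -
  have "e \<in> edges (path_square n)" using assms C by blast
  then show thesis using that unfolding edges_path_square by auto
qed

lemma short_0: "short 0 = 0"
proof -
  have False if "{0, Suc 0} \<in> C"
    using that by (cases rule: edge_cases) (auto simp: doubleton_eq_iff)
  then show ?thesis unfolding short_def of_bool_eq_0_iff by (rule notI)
qed

text \<open>These boundary values keep the degree formulas uniform near the ends of the
  path.\<close>

lemma long_eq_0:
  assumes "i = 0 \<or> n \<le> Suc i"
  shows "long i = 0"
proof -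
  have False if "{i, Suc (Suc i)} \<in> C"
    using that by (cases rule: edge_cases) (use assms in \<open>auto simp: doubleton_eq_iff\<close>)
  then show ?thesis unfolding long_def of_bool_eq_0_iff by (rule notI)
qed

lemma square_fan_mem_spoke: "{0, i} \<in> square_fan ` C \<longleftrightarrow> {i, Suc i} \<in> C"
proof
  assume "{0, i} \<in> square_fan ` C"
  then obtain e where e: "e \<in> C" "{0, i} = square_fan e" by blast
  from e(1) show "{i, Suc i} \<in> C"
    by (cases rule: edge_cases) (use e in \<open>auto simp: doubleton_eq_iff\<close>)
next
  assume "{i, Suc i} \<in> C"
  then show "{0, i} \<in> square_fan ` C" by (metis square_fan_simps(1) imageI)
qed

text \<open>At \<open>i = 0\<close> the set \<open>{i, Suc i}\<close> would be a spoke, the image of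
  \<open>{1, 2}\<close>.\<close>

lemma square_fan_mem_rim:
  assumes "i > 0"
  shows "{i, Suc i} \<in> square_fan ` C \<longleftrightarrow> {i, Suc (Suc i)} \<in> C"
proof
  assume "{i, Suc i} \<in> square_fan ` C"
  then obtain e where e: "e \<in> C" "{i, Suc i} = square_fan e" by blast
  from e(1) show "{i, Suc (Suc i)} \<in> C"
    by (cases rule: edge_cases) (use e assms in \<open>auto simp: doubleton_eq_iff\<close>)
next
  assume "{i, Suc (Suc i)} \<in> C"
  then show "{i, Suc i} \<in> square_fan ` C" by (metis square_fan_simps(2) imageI)
qed

lemma square_fan_edge_cases:
  assumes "e \<in> square_fan ` C"
  obtains i where "1 \<le> i" "i < n" "e = {0, i}" | i where "1 \<le> i" "e = {i, Suc i}"
  using assms by (auto elim!: edge_cases)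

lemma degree_0: "card {e \<in> C. 0 \<in> e} = 0"
proof -
  have "{e \<in> C. 0 \<in> e} = {}" by (auto elim!: edge_cases)
  then show ?thesis by (simp only: card.empty)
qed

lemma degree_1: "card {e \<in> C. Suc 0 \<in> e} = short 1 + long 1"
proof -
  have "{e \<in> C. Suc 0 \<in> e} = C \<inter> {{1, 2}, {1, 3}}"
    by (rule Collect_mem_eq_Int) (auto simp: numeral_eq_Suc elim!: edge_cases)
  then show ?thesis
    by (simp add: card_Int_insert doubleton_eq_iff short_def long_def numeral_eq_Suc)
qed

lemma degree_Suc_Suc:
  "card {e \<in> C. Suc (Suc i) \<in> e} = short (Suc i) + short (Suc (Suc i)) + long i + long (Suc (Suc i))"
proof -
  have "{e \<in> C. Suc (Suc i) \<in> e} = C \<inter> {{Suc i, Suc (Suc i)}, {Suc (Suc i), Suc (Suc (Suc i))},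
      {i, Suc (Suc i)}, {Suc (Suc i), Suc (Suc (Suc (Suc i)))}}"
    by (rule Collect_mem_eq_Int) (auto elim!: edge_cases)
  then show ?thesis
    by (simp add: card_Int_insert doubleton_eq_iff short_def long_def)
qed

lemma fan_degree_Suc:
  "card {e \<in> square_fan ` C. Suc i \<in> e} = short (Suc i) + long (Suc i) + long i"
proof (cases i)
  case 0
  \<comment> \<open>Vertex 1 has no rim edge to its left: \<open>{i, Suc i}\<close> is here its
    spoke, already listed.\<close>
  have "{e \<in> square_fan ` C. Suc i \<in> e} = square_fan ` C \<inter> {{0, Suc i}, {Suc i, Suc (Suc i)}}"
    unfolding 0 by (rule Collect_mem_eq_Int, erule square_fan_edge_cases) auto
  then show ?thesis
    using 0 long_eq_0[of 0]
    by (simp add: card_Int_insert doubleton_eq_iff square_fan_mem_spoke square_fan_mem_rim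
        short_def long_def)
next
  case (Suc m)
  have "{e \<in> square_fan ` C. Suc i \<in> e} =
      square_fan ` C \<inter> {{0, Suc i}, {Suc i, Suc (Suc i)}, {i, Suc i}}"
    unfolding Suc by (rule Collect_mem_eq_Int, erule square_fan_edge_cases) auto
  then show ?thesis
    using Suc by (simp add: card_Int_insert doubleton_eq_iff square_fan_mem_spoke square_fan_mem_rim
        short_def long_def)
qed

lemma fan_degree_0: "card {e \<in> square_fan ` C. 0 \<in> e} = (\<Sum>i<n. short i)"
proof -
  have "{e \<in> square_fan ` C. 0 \<in> e} = (\<lambda>i. {0, i}) ` {i. i < n \<and> {i, Suc i} \<in> C}"
  proof (intro equalityI subsetI)
    fix e assume "e \<in> {e \<in> square_fan ` C. 0 \<in> e}"
    then have e: "e \<in> square_fan ` C" "0 \<in> e" by simp_all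
    from e(1) obtain i where i: "i < n" "e = {0, i}"
    proof (cases rule: square_fan_edge_cases)
      case (2 i)
      then show thesis using e(2) by simp
    qed
    with e(1) have "{i, Suc i} \<in> C" by (simp only: square_fan_mem_spoke)
    with i show "e \<in> (\<lambda>i. {0, i}) ` {i. i < n \<and> {i, Suc i} \<in> C}" by blast
  next
    fix e assume "e \<in> (\<lambda>i. {0, i}) ` {i. i < n \<and> {i, Suc i} \<in> C}"
    then obtain i where "e = {0, i}" "{i, Suc i} \<in> C" by blast
    then show "e \<in> {e \<in> square_fan ` C. 0 \<in> e}"
      by (simp only: square_fan_mem_spoke mem_Collect_eq) simp
  qed
  moreover have "inj_on (\<lambda>i::nat. {0, i}) A" for A
    by (auto simp: inj_on_def doubleton_eq_iff)
  ultimately have "card {e \<in> square_fan ` C. 0 \<in> e} = card {i. i < n \<and> {i, Suc i} \<in> C}"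
    by (simp add: card_image)
  also have "\<dots> = (\<Sum>i<n. short i)"
    by (simp add: short_def Collect_conj_eq lessThan_def sum_of_bool_eq Int_commute)
  finally show ?thesis .
qed

section \<open>Comparison of parities\<close>

lemma even_edges_square_fan: "even_edges (square_fan ` C) \<longleftrightarrow> even_edges C"
proof
  assume "even_edges (square_fan ` C)"
  then have g: "even (short (Suc i) + long (Suc i) + long i)" for i
    unfolding even_edges_def by (metis fan_degree_Suc)
  have "even (card {e \<in> C. v \<in> e})" for v
  proof -
    consider "v = 0" | "v = Suc 0" | i where "v = Suc (Suc i)"
      by (metis not0_implies_Suc)
    then show ?thesis
    proof cases
      case 1
      then show ?thesis using degree_0 by simp
    next
      case 2
      then show ?thesis using g[of 0] long_eq_0[of 0] degree_1 by simp
    next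
      case 3
      \<comment> \<open>The two fan degrees add up to the degree at \<open>v\<close> plus
        \<open>2 * long (Suc i)\<close>.\<close>
      then show ?thesis using g[of i] g[of "Suc i"] degree_Suc_Suc[of i] by auto
    qed
  qed
  then show "even_edges C" by (simp add: even_edges_def)
next
  assume "even_edges C"
  then have d: "even (card {e \<in> C. v \<in> e})" for v by (simp add: even_edges_def)
  \<comment> \<open>Consecutive fan degrees have an even sum, so evenness spreads from vertex 1
    along the rim.\<close>
  have g: "even (short (Suc i) + long (Suc i) + long i)" for i
  proof (induction i)
    case 0
    then show ?case using d[of "Suc 0"] degree_1 long_eq_0[of 0] by simp
  next
    case (Suc i)
    then show ?case using d[of "Suc (Suc i)"] degree_Suc_Suc[of i] by auto
  qed
  \<comment> \<open>For the hub: modulo 2, \<open>short (Suc i)\<close> is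
    \<open>long (Suc i) + long i\<close>, so the sum collapses to \<open>long m\<close>, which
    vanishes at \<open>m = n - 1\<close>.\<close>
  have telescope: "even ((\<Sum>i<Suc m. short i) + long m)" for m
  proof (induction m)
    case 0
    then show ?case using short_0 long_eq_0[of 0] by simp
  next
    case (Suc m)
    then show ?case using g[of m] by auto
  qed
  have "even (\<Sum>i<n. short i)"
  proof (cases n)
    case (Suc m)
    then show ?thesis using telescope[of m] long_eq_0[of m] by simp
  qed simp
  then have "even (card {e \<in> square_fan ` C. v \<in> e})" for v
    using g fan_degree_Suc fan_degree_0 by (cases v) auto
  then show "even_edges (square_fan ` C)" by (simp add: even_edges_def)
qed

end

theorem theorem4p20:
  fixes n :: nat
  assumes "n \<ge> 1"
  shows "matroid_iso (graphic_matroid (path_square n)) (graphic_matroid (fan_graph (n - 1)))"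
proof (rule matroid_iso_graphic_matroidI)
  show "\<forall>e \<in> edges (path_square n). e \<subseteq> verts (path_square n) \<and> card e = 2"
    by (auto simp: path_square_def card_insert_if)
  show "\<forall>e \<in> edges (fan_graph (n - 1)). e \<subseteq> verts (fan_graph (n - 1)) \<and> card e = 2"
    by (auto simp: fan_graph_def)
  show "finite (edges (path_square n))"
    by (rule finite_subset[of _ "Pow {1..n}"]) (auto simp: path_square_def)
  show "finite (edges (fan_graph (n - 1)))"
    by (rule finite_subset[of _ "Pow {0..n}"]) (auto simp: fan_graph_def)
qed (rule bij_betw_square_fan, erule even_edges_square_fan)

end
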